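(* Let $Z\in M_n(\mathbb{R})$ be a symmetric matrix with $Z_{ii}=1$ for all $i$. Suppose that the signature of $Z$ is $(p,q,r)$, and let $v_1,\dots,v_n\in\mathbb{R}^n$ be linearly independent vectors such that $Z=V^tI_{p,q,r}V$ with $V=(v_1\ \dots\ v_n)$. Put $V^{p,q}=(v_1^{p,q}\ \dots\ v_n^{p,q})$ and $A=\mathrm{Aff}\{v_1^{p,q},\dots,v_n^{p,q}\}\subset\mathbb{R}^{p,q}$. Suppose that $Z$ admits a magnitude weighting and $\mathrm{Mag}\,Z\neq0$. Then $$\mathrm{Mag}\,Z=\frac{1}{1-K^{-1}},$$ where $K\ne 0$ is the sectional curvature of the quasi-sphere $A\cap S_{p,q}(1)$, i.e. $K^{-1}$ is its radial scalar square. Furthermore, if $V^{p,q}a\in A$, with $a\in\mathbb{R}^n$ and $\sum_i a_i=1$, is the center of the quasi-sphere $A\cap S_{p,q}(1)$, then a magnitude weighting $w$ of $Z$ is given by $$w=\frac{1}{1-K^{-1}}\,a=\frac{1}{\langle V^{p,q}a,V^{p,q}a\rangle_{p,q}}\,a=\frac{1}{\langle a,a\rangle_Z}\,a .$$ In particular, the following are equivalent: 1. $Z$ admits a positive weighting; 2. $Z$ is spacelike, and the center of the quasi-sphere $A\cap S_{p,q}(1)$ belongs to the interior of the convex hull $\mathrm{Conv}\{v_1^{p,q},\dots,v_n^{p,q}\}$.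
   Context: The signature $(p,q,r)$ of a symmetric $Z\in M_n(\mathbb{R})$ is the number of positive, negative and zero eigenvalues. $I_{p,q,r}$ is the diagonal matrix with $p$ entries $1$, then $q$ entries $-1$, then $r$ entries $0$. $\langle x,y\rangle_Z=x^tZy$. $\mathbb{R}^{p,q}$ is $\mathbb{R}^{p+q}$ with the form $\langle x,y\rangle_{p,q}=x^tI_{p,q,0}\,y$. For $v\in\mathbb{R}^n$, $v^{p,q}\in\mathbb{R}^{p+q}$ is the vector of its first $p+q$ coordinates. $\mathrm{Aff}$ is affine span. $S_{p,q}(1)=\{v\in\mathbb{R}^{p,q}\mid\langle v,v\rangle_{p,q}=1\}$. A magnitude weighting of $Z$ is $w\in\mathbb{R}^n$ with $Zw=(1,\dots,1)^t$; it is positive if $w_i>0$ for all $i$; $\mathrm{Mag}\,Z=\sum_iw_i$. A vector $u$ is perpendicular to an affine subspace $x+W$ ($W$ a linear subspace) if $\langle u,W\rangle_{p,q}=0$. A nonzero vector $u$ is spacelike if $\langle u,u\rangle_{p,q}>0$. A matrix $Z$ admitting a magnitude weighting is spacelike if every nonzero vector of $\mathbb{R}^{p,q}$ perpendicular to $A$ is spacelike (this does not depend on the choice of $V$). Under the hypotheses $A$ is a non-degenerate affine subspace of dimension $p+q-1$ (the form restricted to its direction space is non-degenerate), and $A\cap S_{p,q}(1)$ has the form $\{v\in A\mid\langle x-v,x-v\rangle_{p,q}=\rho\}$ with $x\in A$ the unique vector of $A$ perpendicular to $A$ and $\rho=1-\langle x,x\rangle_{p,q}$. The vector $x$ is its center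 and $\rho$ its radial scalar square. A quasi-sphere of radial scalar square $\rho\neq0$ has constant sectional curvature $K=\rho^{-1}$ with the metric induced from $\langle-,-\rangle_{p,q}$; throughout, $K^{-1}$ stands for $\rho$ (including in low dimensions, where sectional curvature is not literally defined, and in the degenerate case $\rho=0$). "Interior" of the convex hull means interior relative to $A$. *)

theory Defs
  imports Complex_Main "Jordan_Normal_Form.DL_Rank" "Jordan_Normal_Form.Char_Poly"
begin

text \<open>
  Indices start at 0: coordinates of \<open>\<real>\<^sup>n\<close> and the vectors \<open>v 0, \<dots>, v (n - 1)\<close>
  are indexed by \<open>{..<n}\<close>.  The space \<open>\<real>\<^sup>p\<^sup>,\<^sup>q\<close> is \<open>carrier_vec (p + q)\<close> with the form
  \<open>form_pq p q\<close>.
\<close>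

text \<open>
  Eigenvalues are counted with their multiplicity as roots of the characteristic polynomial.
\<close>

definition signature :: "real mat \<Rightarrow> nat \<times> nat \<times> nat" where
  "signature Z =
     (\<Sum>a | eigenvalue Z a \<and> a > 0. order a (char_poly Z),
      \<Sum>a | eigenvalue Z a \<and> a < 0. order a (char_poly Z),
      order 0 (char_poly Z))"

definition I_mat :: "nat \<Rightarrow> nat \<Rightarrow> nat \<Rightarrow> real mat" where
  "I_mat p q r = mat_diag (p + q + r) (\<lambda>i. if i < p then 1 else if i < p + q then -1 else 0)"

definition mat_form :: "real mat \<Rightarrow> real vec \<Rightarrow> real vec \<Rightarrow> real" where
  "mat_form Z x y = x \<bullet> (Z *\<^sub>v y)"

definition form_pq :: "nat \<Rightarrow> nat \<Rightarrow> real vec \<Rightarrow> real vec \<Rightarrow> real" where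
  "form_pq p q = mat_form (I_mat p q 0)"

definition unit_sphere :: "nat \<Rightarrow> nat \<Rightarrow> real vec set" where
  "unit_sphere p q = {v \<in> carrier_vec (p + q). form_pq p q v v = 1}"

definition vec_sum :: "real vec \<Rightarrow> real" where
  "vec_sum x = (\<Sum>i<dim_vec x. x $ i)"

definition is_weighting :: "real mat \<Rightarrow> real vec \<Rightarrow> bool" where
  "is_weighting Z w \<longleftrightarrow> w \<in> carrier_vec (dim_col Z) \<and> Z *\<^sub>v w = vec (dim_row Z) (\<lambda>_. 1)"

definition positive_vec :: "real vec \<Rightarrow> bool" where
  "positive_vec w \<longleftrightarrow> (\<forall>i<dim_vec w. w $ i > 0)"

text \<open>
  For symmetric \<open>Z\<close> all weightings have the same sum, so the magnitude is well defined as soon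
  as a weighting exists.
\<close>

definition Mag :: "real mat \<Rightarrow> real" where
  "Mag Z = (THE s. \<exists>w. is_weighting Z w \<and> s = vec_sum w)"

definition V_mat :: "nat \<Rightarrow> (nat \<Rightarrow> real vec) \<Rightarrow> real mat" where
  "V_mat n v = mat_of_cols n (map v [0..<n])"

definition V_pq :: "nat \<Rightarrow> nat \<Rightarrow> nat \<Rightarrow> (nat \<Rightarrow> real vec) \<Rightarrow> real mat" where
  "V_pq p q n v = mat_of_cols (p + q) (map (\<lambda>i. vec_first (v i) (p + q)) [0..<n])"

definition lin_indep_family :: "nat \<Rightarrow> (nat \<Rightarrow> real vec) \<Rightarrow> bool" where
  "lin_indep_family n v \<longleftrightarrow>
     v ` {..<n} \<subseteq> carrier_vec n \<and> inj_on v {..<n} \<and>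
     LinearCombinations.module.lin_indpt class_ring (module_vec TYPE(real) n) (v ` {..<n})"

definition is_frame :: "nat \<Rightarrow> nat \<Rightarrow> nat \<Rightarrow> nat \<Rightarrow> real mat \<Rightarrow> (nat \<Rightarrow> real vec) \<Rightarrow> bool" where
  "is_frame n p q r Z v \<longleftrightarrow>
     lin_indep_family n v \<and> Z = transpose_mat (V_mat n v) * I_mat p q r * V_mat n v"

text \<open>The affine span and the convex hull of the columns of a matrix.\<close>

definition aff_cols :: "real mat \<Rightarrow> real vec set" where
  "aff_cols X = {X *\<^sub>v a | a. a \<in> carrier_vec (dim_col X) \<and> vec_sum a = 1}"

definition conv_cols :: "real mat \<Rightarrow> real vec set" where
  "conv_cols X =
     {X *\<^sub>v a | a. a \<in> carrier_vec (dim_col X) \<and> (\<forall>i<dim_col X. a $ i \<ge> 0) \<and> vec_sum a = 1}"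

definition aff_span :: "nat \<Rightarrow> nat \<Rightarrow> nat \<Rightarrow> (nat \<Rightarrow> real vec) \<Rightarrow> real vec set" where
  "aff_span p q n v = aff_cols (V_pq p q n v)"

text \<open>The interior of \<open>C\<close> as a subset of \<open>A\<close>, for the Euclidean metric.\<close>

definition interior_in :: "real vec set \<Rightarrow> real vec set \<Rightarrow> real vec set" where
  "interior_in A C =
     {x \<in> A. \<exists>e>0. \<forall>y\<in>A. sqrt ((y - x) \<bullet> (y - x)) < e \<longrightarrow> y \<in> C}"

text \<open>The linear subspace \<open>W\<close> of a nonempty affine subspace \<open>x + W\<close>.\<close>

definition direction :: "real vec set \<Rightarrow> real vec set" where
  "direction A = {y - x | x y. x \<in> A \<and> y \<in> A}"

definition perpendicular :: "nat \<Rightarrow> nat \<Rightarrow> real vec \<Rightarrow> real vec set \<Rightarrow> bool" where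
  "perpendicular p q u A \<longleftrightarrow> (\<forall>d \<in> direction A. form_pq p q u d = 0)"

definition nondegenerate :: "nat \<Rightarrow> nat \<Rightarrow> real vec set \<Rightarrow> bool" where
  "nondegenerate p q A \<longleftrightarrow>
     (\<forall>d \<in> direction A. (\<forall>d' \<in> direction A. form_pq p q d d' = 0) \<longrightarrow> d = 0\<^sub>v (p + q))"

definition spacelike_vec :: "nat \<Rightarrow> nat \<Rightarrow> real vec \<Rightarrow> bool" where
  "spacelike_vec p q u \<longleftrightarrow> u \<in> carrier_vec (p + q) \<and> u \<noteq> 0\<^sub>v (p + q) \<and> form_pq p q u u > 0"

text \<open>
  The condition does not depend on the chosen \<open>v\<close>, so asking for some \<open>v\<close> is the same as asking
  for all \<open>v\<close>.
\<close>

definition spacelike_mat :: "real mat \<Rightarrow> bool" where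
  "spacelike_mat Z \<longleftrightarrow>
     (\<exists>w. is_weighting Z w) \<and>
     (\<exists>p q r v. signature Z = (p, q, r) \<and> is_frame (dim_row Z) p q r Z v \<and>
        (\<forall>u \<in> carrier_vec (p + q).
           u \<noteq> 0\<^sub>v (p + q) \<and> perpendicular p q u (aff_span p q (dim_row Z) v)
           \<longrightarrow> spacelike_vec p q u))"

definition quasi_sphere :: "nat \<Rightarrow> nat \<Rightarrow> real vec set \<Rightarrow> real vec \<Rightarrow> real \<Rightarrow> real vec set" where
  "quasi_sphere p q A x \<rho> = {v \<in> A. form_pq p q (x - v) (x - v) = \<rho>}"

text \<open>
  The center of \<open>A \<inter> unit_sphere p q\<close> is the unique vector of \<open>A\<close> perpendicular to \<open>A\<close>.
\<close>

definition qs_center :: "nat \<Rightarrow> nat \<Rightarrow> real vec set \<Rightarrow> real vec" where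
  "qs_center p q A = (THE x. x \<in> A \<and> perpendicular p q x A)"

text \<open>
  The radial scalar square of \<open>A \<inter> unit_sphere p q\<close>.  It plays the role of the inverse
  \<open>1 / K\<close> of the sectional curvature, also when it is 0 (where \<open>K\<close> is infinite).
\<close>

definition qs_radial_square :: "nat \<Rightarrow> nat \<Rightarrow> real vec set \<Rightarrow> real" where
  "qs_radial_square p q A = 1 - form_pq p q (qs_center p q A) (qs_center p q A)"

end

theory Submission
  imports Defs
begin

text \<open>
Write \<open>X\<close> for the matrix with columns \<open>v\<^sub>i\<^sup>p\<^sup>,\<^sup>q\<close> and \<open>\<langle>x, y\<rangle>\<close> for the form on \<open>\<real>\<^sup>p\<^sup>,\<^sup>q\<close>.  The vanishing last
diagonal entries of \<open>I_mat p q r\<close> make \<open>Z\<close> the Gram matrix of these columns, so that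
\<open>\<langle>Xa, Xb\<rangle> = a\<^sup>t Z b\<close>.  If \<open>w\<close> is a weighting, the vector \<open>y = Xw\<close> therefore satisfies
\<open>\<langle>y, Xa\<rangle> = \<Sum>\<^sub>i a\<^sub>i\<close> for all \<open>a\<close>: pairing with \<open>y\<close> reads off the coordinate sum, and in particular
\<open>\<langle>y, y\<rangle> = Mag Z\<close>.  Since the \<open>v\<^sub>i\<close> form a basis, \<open>X\<close> is onto, and so
\<open>A = {x. \<langle>y, x\<rangle> = 1}\<close> with direction space \<open>{u. \<langle>y, u\<rangle> = 0}\<close>.  In the language of quadrics,
\<open>y\<close> is the pole of the hyperplane \<open>A\<close> with respect to the unit sphere.

Everything follows from \<open>\<langle>y, y\<rangle> = Mag Z \<noteq> 0\<close>.  The space splits orthogonally into the line through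
\<open>y\<close> and its orthogonal complement, so the vectors perpendicular to \<open>A\<close> are exactly the multiples of
\<open>y\<close>.  The only multiple on \<open>A\<close> is \<open>y / Mag Z\<close>; this is the center \<open>x\<close>.  By the Pythagorean
theorem a point of \<open>A\<close> has square 1 exactly if its difference to \<open>x\<close> has square \<open>1 - \<langle>x, x\<rangle>\<close>, so
\<open>1 - K\<^sup>-\<^sup>1 = \<langle>x, x\<rangle> = 1 / Mag Z\<close>.  If \<open>Xa\<close> is the center, then \<open>Za\<close> is constant with value
\<open>1 / Mag Z\<close>, so \<open>a\<close> multiplied by \<open>Mag Z\<close> is a weighting.

For the equivalence, \<open>Z\<close> is spacelike exactly if \<open>\<langle>y, y\<rangle> = Mag Z\<close> is positive
(\<open>perpendicular_vectors_spacelike_iff\<close>).  Because this sign is read off from \<open>Z\<close> alone, the choice of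
the vectors \<open>v\<^sub>i\<close> does not matter.  Because \<open>X\<close> is onto, the points interior to the convex hull are
those with a representation by strictly positive barycentric coordinates
(\<open>interior_conv_if_positive\<close>, \<open>positive_if_interior_conv\<close>), and for \<open>Mag Z > 0\<close> multiplication by \<open>Mag Z\<close>
takes such coordinates of the center to a positive weighting and back.

The argument needs \<open>p + q + r = n\<close>, that is, that the eigenvalues of a real symmetric matrix are real
and so exhaust the degree of the characteristic polynomial (\<open>signature_sum\<close>).
\<close>

section \<open>The signature of a real symmetric matrix\<close>

text \<open>
A real symmetric matrix is Hermitian: for an eigenvector \<open>u\<close>, moving the matrix across the
Hermitian product of \<open>u\<close> with itself turns the factor \<open>k\<close> into its conjugate.
\<close>

lemma eigenvalue_of_symmetric_real:
  fixes Z :: "real mat"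
  assumes Z: "Z \<in> carrier_mat n n" and sym: "transpose_mat Z = Z"
    and ev: "eigenvalue (map_mat complex_of_real Z) k"
  shows "k \<in> \<real>"
proof -
  define M where "M = map_mat complex_of_real Z"
  have M: "M \<in> carrier_mat n n" using Z by (simp add: M_def)
  have symM: "transpose_mat M = M"
    using arg_cong[OF sym, of "map_mat complex_of_real"] Z
    by (simp add: M_def map_mat_transpose)
  obtain u where u: "u \<in> carrier_vec n" "u \<noteq> 0\<^sub>v n" and Mu: "M *\<^sub>v u = k \<cdot>\<^sub>v u"
    using ev Z unfolding eigenvalue_def eigenvector_def M_def by auto
  have real: "M *\<^sub>v conjugate u = conjugate (M *\<^sub>v u)"
    using u Z by (intro eq_vecI) (auto simp: M_def scalar_prod_def)
  have "k * (u \<bullet>c u) = (M *\<^sub>v u) \<bullet> conjugate u"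
    using u by (simp add: Mu)
  also have "\<dots> = u \<bullet> (M *\<^sub>v conjugate u)"
    using transpose_vec_mult_scalar[OF M, of "conjugate u" u] u by (simp add: symM)
  also have "\<dots> = cnj k * (u \<bullet>c u)"
    using u by (simp add: real Mu conjugate_smult_vec)
  finally have "k = cnj k" using u by simp
  then show ?thesis by (metis Reals_cnj_iff)
qed

text \<open>
Over the complex numbers the characteristic polynomial splits.  Its roots are real, so the
factorization is the image of a real one, and the embedding of polynomials is injective.
\<close>

lemma char_poly_symmetric_splits:
  fixes Z :: "real mat"
  assumes Z: "Z \<in> carrier_mat n n" and sym: "transpose_mat Z = Z"
  shows "\<exists>bs. char_poly Z = (\<Prod>b\<leftarrow>bs. [:- b, 1:]) \<and> length bs = n"
proof -
  let ?M = "map_mat complex_of_real Z"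
  have M: "?M \<in> carrier_mat n n" using Z by simp
  obtain as where as: "char_poly ?M = (\<Prod>a\<leftarrow>as. [:- a, 1:])" "length as = n"
    using char_poly_factorized[OF M] by auto
  have "a \<in> \<real>" if "a \<in> set as" for a
  proof (rule eigenvalue_of_symmetric_real[OF Z sym])
    show "eigenvalue ?M a"
      using that unfolding eigenvalue_root_char_poly[OF M] as(1)
      by (induction as) auto
  qed
  then have re: "map (complex_of_real \<circ> Re) as = as"
    by (intro map_idI) (auto simp: complex_is_Real_iff complex_eq_iff)
  interpret of_real_poly: map_poly_inj_idom_hom complex_of_real ..
  have "map_poly complex_of_real (\<Prod>b\<leftarrow>map Re as. [:- b, 1:]) = (\<Prod>a\<leftarrow>map (complex_of_real \<circ> Re) as. [:- a, 1:])"
    by (induction as) (simp_all add: of_real_poly.hom_mult del: mult_pCons_left)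
  then have "map_poly complex_of_real (\<Prod>b\<leftarrow>map Re as. [:- b, 1:]) = map_poly complex_of_real (char_poly Z)"
    using as(1) by (simp only: re of_real_hom.char_poly_hom[OF Z])
  then have "char_poly Z = (\<Prod>b\<leftarrow>map Re as. [:- b, 1:])"
    by simp
  then show ?thesis using as(2) by (intro exI[of _ "map Re as"]) simp
qed

lemma order_prod_linear_factors:
  "order x (\<Prod>b\<leftarrow>bs. [:- b, 1:]) = count_list bs (x :: 'a :: idom)"
proof (induction bs)
  case (Cons b bs)
  have nz: "(\<Prod>b\<leftarrow>bs. [:- b, 1:]) \<noteq> (0 :: 'a poly)"
    by (auto simp: prod_list_zero_iff)
  have "order x [:- b, 1:] = (if x = b then 1 else 0)"
    using order_power_n_n[of b 1] by (auto intro: order_0I)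
  with Cons nz show ?case by (simp add: order_mult del: mult_pCons_left)
qed simp

text \<open>
The three entries of the signature count, with multiplicity, the positive, negative and zero members
of a list of \<open>n\<close> real roots.
\<close>

lemma signature_sum:
  assumes Z: "Z \<in> carrier_mat n n" and sym: "transpose_mat Z = Z"
    and sig: "signature Z = (p, q, r)"
  shows "p + q + r = n"
proof -
  obtain bs where bs: "char_poly Z = (\<Prod>b\<leftarrow>bs. [:- b, 1:])" "length bs = n"
    using char_poly_symmetric_splits[OF Z sym] by auto
  have ev: "eigenvalue Z a \<longleftrightarrow> a \<in> set bs" for a
    unfolding eigenvalue_root_char_poly[OF Z] bs(1) by (induction bs) auto
  have ord: "order a (char_poly Z) = count_list bs a" for a
    unfolding bs(1) by (rule order_prod_linear_factors)
  have "n = (\<Sum>a\<in>set bs \<union> {0}. count_list bs a)"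
    using sum_count_set[of bs "set bs \<union> {0}", OF Un_upper1] bs(2) by simp
  also have "set bs \<union> {0} = {a \<in> set bs. a > 0} \<union> {a \<in> set bs. a < 0} \<union> {0}"
    by auto
  also have "(\<Sum>a\<in>\<dots>. count_list bs a)
      = (\<Sum>a | a \<in> set bs \<and> a > 0. count_list bs a) + (\<Sum>a | a \<in> set bs \<and> a < 0. count_list bs a)
        + count_list bs 0"
    by (subst sum.union_disjoint, force, force, force, subst sum.union_disjoint) auto
  finally show ?thesis using sig by (simp add: signature_def ev ord)
qed

section \<open>Coordinate sums and magnitude\<close>

lemma vec_sum_add:
  "x \<in> carrier_vec n \<Longrightarrow> y \<in> carrier_vec n \<Longrightarrow> vec_sum (x + y) = vec_sum x + vec_sum y"
  by (auto simp: vec_sum_def sum.distrib)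

lemma vec_sum_smult: "vec_sum (k \<cdot>\<^sub>v x) = k * vec_sum x"
  by (simp add: vec_sum_def sum_distrib_left)

lemma scalar_prod_ones: "x \<in> carrier_vec n \<Longrightarrow> x \<bullet> vec n (\<lambda>_. 1) = vec_sum x"
  by (auto simp: vec_sum_def scalar_prod_def atLeast0LessThan)

text \<open>
Two weightings have the same sum, since by symmetry \<open>w'\<^sup>t 1 = w'\<^sup>t Z w = (Z w')\<^sup>t w = 1\<^sup>t w\<close>.
\<close>

lemma Mag_eq_vec_sum:
  assumes Z: "Z \<in> carrier_mat n n" and sym: "transpose_mat Z = Z" and w: "is_weighting Z w"
  shows "Mag Z = vec_sum w"
proof -
  have "vec_sum w' = vec_sum w" if w': "is_weighting Z w'" for w'
  proof -
    have carr: "w \<in> carrier_vec n" "w' \<in> carrier_vec n"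
      and Zw: "Z *\<^sub>v w = vec n (\<lambda>_. 1)" "Z *\<^sub>v w' = vec n (\<lambda>_. 1)"
      using w w' Z by (auto simp: is_weighting_def)
    have "vec_sum w' = w' \<bullet> (Z *\<^sub>v w)"
      using carr by (simp add: Zw scalar_prod_ones)
    also have "\<dots> = (Z *\<^sub>v w') \<bullet> w"
      using transpose_vec_mult_scalar[OF Z carr] by (simp only: sym)
    also have "\<dots> = vec_sum w"
      using comm_scalar_prod[of w n "vec n (\<lambda>_. 1)"] carr
      by (simp add: Zw scalar_prod_ones)
    finally show ?thesis .
  qed
  then show ?thesis
    unfolding Mag_def using w by (intro the_equality) blast+
qed

section \<open>The form on \<open>\<real>\<^sup>p\<^sup>,\<^sup>q\<close>\<close>

abbreviation sgn_pq :: "nat \<Rightarrow> nat \<Rightarrow> real" where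
  "sgn_pq p i \<equiv> (if i < p then 1 else - 1)"

lemma I_mat_carrier [simp]: "I_mat p q r \<in> carrier_mat (p + q + r) (p + q + r)"
  by (simp add: I_mat_def mat_diag_def)

lemma dim_I_mat [simp]: "dim_row (I_mat p q r) = p + q + r" "dim_col (I_mat p q r) = p + q + r"
  by (simp_all add: I_mat_def mat_diag_def)

lemma index_I_mat:
  "i < p + q + r \<Longrightarrow> j < p + q + r \<Longrightarrow>
    I_mat p q r $$ (i, j) = (if i = j then if i < p + q then sgn_pq p i else 0 else 0)"
  by (simp add: I_mat_def mat_diag_def)

lemma form_pq_sum:
  assumes "y \<in> carrier_vec (p + q)"
  shows "form_pq p q x y = (\<Sum>i<p+q. sgn_pq p i * x $ i * y $ i)"
proof -
  have "(I_mat p q 0 *\<^sub>v y) $ i = sgn_pq p i * y $ i" if "i < p + q" for i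
  proof -
    have "(I_mat p q 0 *\<^sub>v y) $ i = (\<Sum>j<p+q. I_mat p q 0 $$ (i, j) * y $ j)"
      using that assms by (auto simp: scalar_prod_def atLeast0LessThan)
    also have "\<dots> = (\<Sum>j<p+q. if j = i then sgn_pq p i * y $ i else 0)"
      using that by (intro sum.cong) (auto simp: index_I_mat)
    finally show ?thesis using that by simp
  qed
  then show ?thesis
    by (auto simp: form_pq_def mat_form_def scalar_prod_def I_mat_def mat_diag_def
        atLeast0LessThan mult_ac intro!: sum.cong)
qed

lemma form_pq_commute:
  "x \<in> carrier_vec (p + q) \<Longrightarrow> y \<in> carrier_vec (p + q) \<Longrightarrow> form_pq p q x y = form_pq p q y x"
  by (auto simp: form_pq_sum mult_ac intro!: sum.cong)

lemma form_pq_add_right: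
  "y \<in> carrier_vec (p + q) \<Longrightarrow> z \<in> carrier_vec (p + q)
    \<Longrightarrow> form_pq p q x (y + z) = form_pq p q x y + form_pq p q x z"
  by (simp add: form_pq_sum distrib_left sum.distrib)

lemma form_pq_diff_right:
  "y \<in> carrier_vec (p + q) \<Longrightarrow> z \<in> carrier_vec (p + q)
    \<Longrightarrow> form_pq p q x (y - z) = form_pq p q x y - form_pq p q x z"
  by (simp add: form_pq_sum algebra_simps flip: sum_subtractf)

lemma form_pq_diff_left:
  "x \<in> carrier_vec (p + q) \<Longrightarrow> y \<in> carrier_vec (p + q) \<Longrightarrow> z \<in> carrier_vec (p + q)
    \<Longrightarrow> form_pq p q (x - y) z = form_pq p q x z - form_pq p q y z"
  by (simp add: form_pq_sum algebra_simps flip: sum_subtractf)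

lemma form_pq_smult_right:
  "y \<in> carrier_vec (p + q) \<Longrightarrow> form_pq p q x (k \<cdot>\<^sub>v y) = k * form_pq p q x y"
  by (simp add: form_pq_sum sum_distrib_left mult_ac)

lemma form_pq_smult_left:
  "x \<in> carrier_vec (p + q) \<Longrightarrow> y \<in> carrier_vec (p + q)
    \<Longrightarrow> form_pq p q (k \<cdot>\<^sub>v x) y = k * form_pq p q x y"
  by (simp add: form_pq_sum sum_distrib_left mult_ac)

lemma form_pq_nondegenerate:
  assumes x: "x \<in> carrier_vec (p + q)" and orth: "\<And>y. y \<in> carrier_vec (p + q) \<Longrightarrow> form_pq p q x y = 0"
  shows "x = 0\<^sub>v (p + q)"
proof
  fix i assume i: "i < dim_vec (0\<^sub>v (p + q) :: real vec)"
  \<comment> \<open>Pairing with a unit vector isolates one coordinate, up to sign.\<close>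
  have "form_pq p q x (unit_vec (p + q) i) = (\<Sum>j<p+q. if j = i then sgn_pq p i * x $ i else 0)"
    unfolding form_pq_sum[OF unit_vec_carrier] using i by (intro sum.cong) auto
  then show "x $ i = 0\<^sub>v (p + q) $ i"
    using orth[of "unit_vec (p + q) i"] i by (simp split: if_splits)
qed (use x in simp)

section \<open>Frames and truncation of coordinates\<close>

text \<open>
Independent columns give full rank, hence a nonzero determinant and an inverse.
\<close>

lemma lin_indep_family_invertible:
  assumes "lin_indep_family n v"
  shows "\<exists>B \<in> carrier_mat n n. V_mat n v * B = 1\<^sub>m n"
proof -
  have carr: "v ` {..<n} \<subseteq> carrier_vec n" and inj: "inj_on v {..<n}"
    and ind: "LinearCombinations.module.lin_indpt class_ring (module_vec TYPE(real) n) (v ` {..<n})"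
    using assms by (auto simp: lin_indep_family_def)
  have V: "V_mat n v \<in> carrier_mat n n" by (auto simp: V_mat_def)
  have cols: "cols (V_mat n v) = map v [0..<n]"
    unfolding V_mat_def using carr by (intro cols_mat_of_cols) auto
  have "vec_space.rank n (V_mat n v) = n"
    using V inj ind
    by (intro vec_space.lin_indpt_full_rank) (auto simp: cols distinct_map atLeast0LessThan)
  then have "det (V_mat n v) \<noteq> 0"
    using vec_space.det_rank_iff[OF V] by simp
  from det_non_zero_imp_unit[OF V this, of "()"] show ?thesis
    by (auto simp: Units_def ring_mat_def)
qed

text \<open>
Truncating the columns of a matrix deletes its last rows; deleting the corresponding columns of its
inverse leaves a right inverse.  This is how linear independence of the full vectors makes the
truncated ones span \<open>\<real>\<^sup>p\<^sup>,\<^sup>q\<close>, although they may be dependent.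
\<close>

lemma frame_right_inverse:
  assumes "lin_indep_family n v" and "p + q \<le> n"
  shows "\<exists>R \<in> carrier_mat n (p + q). V_pq p q n v * R = 1\<^sub>m (p + q)"
proof -
  obtain B where B: "B \<in> carrier_mat n n" and VB: "V_mat n v * B = 1\<^sub>m n"
    using lin_indep_family_invertible[OF assms(1)] by auto
  let ?R = "mat n (p + q) (\<lambda>(i, j). B $$ (i, j))"
  have "(V_pq p q n v * ?R) $$ (i, j) = (V_mat n v * B) $$ (i, j)" if "i < p + q" "j < p + q" for i j
    using that assms B
    by (auto simp: V_pq_def V_mat_def vec_first_def mat_of_cols_def scalar_prod_def intro!: sum.cong)
  then have "V_pq p q n v * ?R = 1\<^sub>m (p + q)"
    using assms(2) by (intro eq_matI) (auto simp: VB V_pq_def)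
  then show ?thesis by (intro bexI[of _ ?R]) auto
qed

text \<open>
The last \<open>r\<close> coordinates are multiplied by zero in the form, so dropping them does not change the
matrix.  The equation \<open>p + q + r = n\<close> makes the sizes in the product fit.
\<close>

lemma gram_matrix_truncate:
  assumes v: "lin_indep_family n v" and n: "p + q + r = n"
    and Z: "Z = transpose_mat (V_mat n v) * I_mat p q r * V_mat n v"
  shows "Z = transpose_mat (V_pq p q n v) * I_mat p q 0 * V_pq p q n v"
proof -
  let ?V = "V_mat n v" and ?X = "V_pq p q n v"
  have V: "?V \<in> carrier_mat n n" and X: "?X \<in> carrier_mat (p + q) n"
    by (auto simp: V_mat_def V_pq_def)
  have I: "(transpose_mat A * I_mat p q s) $$ (i, k) = (if k < p + q then sgn_pq p k * A $$ (k, i) else 0)"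
    if "A \<in> carrier_mat (p + q + s) n" "i < n" "k < p + q + s" for A s i k
  proof -
    have "(transpose_mat A * I_mat p q s) $$ (i, k)
        = (\<Sum>j<p+q+s. A $$ (j, i) * I_mat p q s $$ (j, k))"
      using that by (auto simp: scalar_prod_def atLeast0LessThan)
    also have "\<dots> = (\<Sum>j<p+q+s. if j = k then (if k < p + q then sgn_pq p k * A $$ (k, i) else 0) else 0)"
      using that by (intro sum.cong) (auto simp: index_I_mat)
    finally show ?thesis using that by simp
  qed
  have VX: "?V $$ (k, i) = ?X $$ (k, i)" if "k < p + q" "i < n" for k i
    using that n by (simp add: V_mat_def V_pq_def vec_first_def mat_of_cols_def)
  show ?thesis
  proof (rule eq_matI)
    fix i j assume "i < dim_row (transpose_mat ?X * I_mat p q 0 * ?X)"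
      and "j < dim_col (transpose_mat ?X * I_mat p q 0 * ?X)"
    then have ij: "i < n" "j < n" using X by auto
    have "Z $$ (i, j) = (\<Sum>k<n. (transpose_mat ?V * I_mat p q r) $$ (i, k) * ?V $$ (k, j))"
      unfolding Z using V ij n
      by (auto simp: scalar_prod_def atLeast0LessThan I_mat_def mat_diag_def intro!: sum.cong)
    also have "\<dots> = (\<Sum>k<n. if k < p + q then sgn_pq p k * ?X $$ (k, i) * ?X $$ (k, j) else 0)"
      using I[of ?V r] V ij n by (intro sum.cong) (auto simp: VX)
    also have "\<dots> = (\<Sum>k<p+q. sgn_pq p k * ?X $$ (k, i) * ?X $$ (k, j))"
      using n by (intro sum.mono_neutral_cong_right) auto
    also have "\<dots> = (\<Sum>k<p+q. (transpose_mat ?X * I_mat p q 0) $$ (i, k) * ?X $$ (k, j))"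
      using I[of ?X 0] X ij by (intro sum.cong) auto
    also have "\<dots> = (transpose_mat ?X * I_mat p q 0 * ?X) $$ (i, j)"
      using X ij
      by (auto simp: scalar_prod_def atLeast0LessThan I_mat_def mat_diag_def intro!: sum.cong)
    finally show "Z $$ (i, j) = (transpose_mat ?X * I_mat p q 0 * ?X) $$ (i, j)" .
  qed (use V X in \<open>auto simp: Z\<close>)
qed

section \<open>Bounds on linear maps\<close>

lemma abs_index_le_norm:
  fixes u :: "real vec"
  assumes "i < dim_vec u"
  shows "\<bar>u $ i\<bar> \<le> sqrt (u \<bullet> u)"
proof -
  have "u $ i * u $ i \<le> (\<Sum>j = 0..<dim_vec u. u $ j * u $ j)"
    using assms by (intro member_le_sum) auto
  then have "(u $ i)\<^sup>2 \<le> u \<bullet> u"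
    by (simp add: scalar_prod_def power2_eq_square)
  then show ?thesis by (metis real_sqrt_abs real_sqrt_le_mono)
qed

text \<open>
A linear map is bounded.  The crude constant, one plus the sum of all absolute entries, is positive
even for an empty matrix, so that it can be divided by.
\<close>

lemma abs_mult_mat_vec_le:
  fixes R :: "real mat"
  assumes R: "R \<in> carrier_mat n d"
  shows "\<exists>c>0. \<forall>u \<in> carrier_vec d. \<forall>i<n. \<bar>(R *\<^sub>v u) $ i\<bar> \<le> c * sqrt (u \<bullet> u)"
proof -
  define c where "c = 1 + (\<Sum>i<n. \<Sum>j<d. \<bar>R $$ (i, j)\<bar>)"
  have "\<bar>(R *\<^sub>v u) $ i\<bar> \<le> c * sqrt (u \<bullet> u)" if u: "u \<in> carrier_vec d" and i: "i < n" for u i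
  proof -
    have "(R *\<^sub>v u) $ i = (\<Sum>j<d. R $$ (i, j) * u $ j)"
      using R u i by (auto simp: scalar_prod_def atLeast0LessThan)
    then have "\<bar>(R *\<^sub>v u) $ i\<bar> \<le> (\<Sum>j<d. \<bar>R $$ (i, j)\<bar> * \<bar>u $ j\<bar>)"
      using sum_abs[of "\<lambda>j. R $$ (i, j) * u $ j" "{..<d}"] by (simp add: abs_mult)
    also have "\<dots> \<le> (\<Sum>j<d. \<bar>R $$ (i, j)\<bar> * sqrt (u \<bullet> u))"
      using u by (intro sum_mono mult_left_mono abs_index_le_norm) auto
    also have "\<dots> = (\<Sum>j<d. \<bar>R $$ (i, j)\<bar>) * sqrt (u \<bullet> u)"
      by (simp add: sum_distrib_right)
    also have "\<dots> \<le> c * sqrt (u \<bullet> u)"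
    proof (rule mult_right_mono)
      have "(\<Sum>j<d. \<bar>R $$ (i, j)\<bar>) \<le> (\<Sum>i<n. \<Sum>j<d. \<bar>R $$ (i, j)\<bar>)"
        using i by (intro member_le_sum sum_nonneg) auto
      then show "(\<Sum>j<d. \<bar>R $$ (i, j)\<bar>) \<le> c" by (simp add: c_def)
      show "0 \<le> sqrt (u \<bullet> u)" by (simp add: scalar_prod_def sum_nonneg)
    qed
    finally show ?thesis .
  qed
  moreover have "c > 0"
    unfolding c_def by (intro add_pos_nonneg sum_nonneg) auto
  ultimately show ?thesis by blast
qed

text \<open>
Including 1 among the candidates for the minimum covers the case \<open>n = 0\<close>.
\<close>

lemma positive_lower_bound:
  fixes a :: "nat \<Rightarrow> real"
  assumes "\<And>i. i < n \<Longrightarrow> a i > 0"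
  shows "\<exists>\<delta>>0. \<forall>i<n. \<delta> \<le> a i"
proof -
  have "Min (insert 1 (a ` {..<n})) > 0" using assms by auto
  then show ?thesis
    by (intro exI[of _ "Min (insert 1 (a ` {..<n}))"]) (auto intro!: Min_le)
qed

section \<open>The pole of the affine span\<close>

lemma perpendicularD:
  assumes "perpendicular p q u A" "x \<in> A" "y \<in> A"
  shows "form_pq p q u (y - x) = 0"
  using assms unfolding perpendicular_def direction_def by blast

text \<open>
The points of \<open>\<real>\<^sup>p\<^sup>,\<^sup>q\<close> are the columns of \<open>X\<close>, with Gram matrix \<open>Z\<close>.  That they span
is stated through a right inverse because it supplies coordinates that depend linearly, hence
continuously, on the point.
\<close>

locale weighted_configuration =
  fixes p q n :: nat and X Z :: "real mat" and w :: "real vec"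
  assumes X [simp]: "X \<in> carrier_mat (p + q) n"
    and surjective: "\<exists>R \<in> carrier_mat n (p + q). X * R = 1\<^sub>m (p + q)"
    and gram: "Z = transpose_mat X * I_mat p q 0 * X"
    and weighting: "is_weighting Z w"
    and total_nonzero: "vec_sum w \<noteq> 0"
begin

abbreviation form (infixl "\<diamondop>" 70) where "x \<diamondop> y \<equiv> form_pq p q x y"

abbreviation A where "A \<equiv> aff_cols X"

text \<open>
The pole of the hyperplane \<open>A\<close> with respect to the unit sphere; its polar equation is proved as
\<open>A_eq\<close>.  It depends only on \<open>Z\<close> and \<open>X\<close> by \<open>image_of_weighting\<close>.
\<close>

definition pole where "pole = X *\<^sub>v w"

definition center where "center = (1 / vec_sum w) \<cdot>\<^sub>v pole"

lemma X_dim [simp]: "dim_row X = p + q" "dim_col X = n"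
  by (fact carrier_matD[OF X])+

definition R where "R = (SOME R. R \<in> carrier_mat n (p + q) \<and> X * R = 1\<^sub>m (p + q))"

lemma R [simp]: "R \<in> carrier_mat n (p + q)" and right_inverse: "X * R = 1\<^sub>m (p + q)"
  using someI_ex[OF surjective[unfolded Bex_def]] by (simp_all add: R_def)

lemma R_dim [simp]: "dim_row R = n" "dim_col R = p + q"
  by (fact carrier_matD[OF R])+

lemma I_carrier [simp]: "I_mat p q 0 \<in> carrier_mat (p + q) (p + q)"
  using I_mat_carrier[of p q 0] by simp

lemma Z_carrier [simp]: "Z \<in> carrier_mat n n"
  unfolding gram by (rule carrier_matI) simp_all

lemma Z_dim [simp]: "dim_row Z = n" "dim_col Z = n"
  by (fact carrier_matD[OF Z_carrier])+

lemma w_carrier [simp]: "w \<in> carrier_vec n"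
  using weighting Z_carrier unfolding is_weighting_def by auto

lemma Z_w: "Z *\<^sub>v w = vec n (\<lambda>_. 1)"
  using weighting Z_carrier unfolding is_weighting_def by auto

lemma pole_carrier [simp]: "pole \<in> carrier_vec (p + q)"
  by (simp add: pole_def mult_mat_vec_carrier[OF X])

lemma pole_dim [simp]: "dim_vec pole = p + q"
  by (rule carrier_vecD) simp

lemma zero_smult_pole [simp]: "0 \<cdot>\<^sub>v pole = 0\<^sub>v (p + q)"
  by (intro eq_vecI) auto

lemma center_carrier [simp]: "center \<in> carrier_vec (p + q)"
  by (simp add: center_def)

lemma center_dim [simp]: "dim_vec center = p + q"
  by (rule carrier_vecD) simp

lemma X_mult_carrier [simp]: "a \<in> carrier_vec n \<Longrightarrow> X *\<^sub>v a \<in> carrier_vec (p + q)"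
  by (rule mult_mat_vec_carrier[OF X])

lemma R_mult_carrier [simp]: "u \<in> carrier_vec (p + q) \<Longrightarrow> R *\<^sub>v u \<in> carrier_vec n"
  by (rule mult_mat_vec_carrier[OF R])

lemma X_R [simp]: "u \<in> carrier_vec (p + q) \<Longrightarrow> X *\<^sub>v (R *\<^sub>v u) = u"
  using assoc_mult_mat_vec[OF X R, of u] by (simp add: right_inverse)

lemma Z_mult:
  assumes a: "a \<in> carrier_vec n"
  shows "Z *\<^sub>v a = transpose_mat X *\<^sub>v (I_mat p q 0 *\<^sub>v (X *\<^sub>v a))"
proof -
  have T: "transpose_mat X \<in> carrier_mat n (p + q)" by simp
  have TI: "transpose_mat X * I_mat p q 0 \<in> carrier_mat n (p + q)"
    by (rule mult_carrier_mat[OF T I_carrier])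
  show ?thesis
    unfolding gram assoc_mult_mat_vec[OF TI X a]
    by (rule assoc_mult_mat_vec[OF T I_carrier X_mult_carrier[OF a]])
qed

lemma mat_form_eq_form:
  assumes a: "a \<in> carrier_vec n" and b: "b \<in> carrier_vec n"
  shows "mat_form Z a b = (X *\<^sub>v a) \<diamondop> (X *\<^sub>v b)"
proof -
  let ?y = "I_mat p q 0 *\<^sub>v (X *\<^sub>v b)"
  have y: "?y \<in> carrier_vec (p + q)"
    by (rule mult_mat_vec_carrier[OF I_carrier X_mult_carrier[OF b]])
  have "a \<bullet> (transpose_mat X *\<^sub>v ?y) = (transpose_mat X *\<^sub>v ?y) \<bullet> a"
    using mult_mat_vec_carrier[OF _ y, of "transpose_mat X" n] a
    by (intro comm_scalar_prod[of _ n]) auto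
  also have "\<dots> = ?y \<bullet> (X *\<^sub>v a)"
    by (rule transpose_vec_mult_scalar[OF X a y])
  also have "\<dots> = (X *\<^sub>v a) \<bullet> ?y"
    using a y by (intro comm_scalar_prod[of _ "p + q"]) auto
  finally show ?thesis
    by (simp add: mat_form_def form_pq_def Z_mult[OF b])
qed

text \<open>
The defining equation \<open>Zw' = 1\<close> read through the form: \<open>\<langle>Xw', Xa\<rangle> = a\<^sup>t Z w' = a\<^sup>t 1\<close>.
\<close>

lemma weighting_pairing:
  assumes w': "is_weighting Z w'" and a: "a \<in> carrier_vec n"
  shows "(X *\<^sub>v w') \<diamondop> (X *\<^sub>v a) = vec_sum a"
proof -
  have c: "w' \<in> carrier_vec n" using w' by (simp add: is_weighting_def)
  have "(X *\<^sub>v w') \<diamondop> (X *\<^sub>v a) = mat_form Z a w'"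
    using a c by (simp add: mat_form_eq_form form_pq_commute[of "X *\<^sub>v w'"])
  also have "\<dots> = vec_sum a"
    using a w' by (simp add: mat_form_def is_weighting_def scalar_prod_ones)
  finally show ?thesis .
qed

text \<open>
Weightings may differ by a kernel vector of \<open>Z\<close>.  Their images pair equally with all of
\<open>\<real>\<^sup>p\<^sup>,\<^sup>q\<close>, so they agree by nondegeneracy of the form.
\<close>

lemma image_of_weighting:
  assumes w': "is_weighting Z w'"
  shows "X *\<^sub>v w' = pole"
proof -
  have c: "w' \<in> carrier_vec n" using w' by (simp add: is_weighting_def)
  have "X *\<^sub>v w' - pole = 0\<^sub>v (p + q)"
  proof (rule form_pq_nondegenerate)
    fix x :: "real vec" assume x: "x \<in> carrier_vec (p + q)"
    show "(X *\<^sub>v w' - pole) \<diamondop> x = 0"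
      using weighting_pairing[OF w', of "R *\<^sub>v x"] weighting_pairing[OF weighting, of "R *\<^sub>v x"] x c
      by (simp add: form_pq_diff_left pole_def)
  qed (use c in simp)
  then have "(X *\<^sub>v w' - pole) $ i = 0" if "i < p + q" for i
    using that by simp
  then show ?thesis by (intro eq_vecI) auto
qed

lemma pole_pairing: "a \<in> carrier_vec n \<Longrightarrow> pole \<diamondop> (X *\<^sub>v a) = vec_sum a"
  using weighting_pairing[OF weighting] by (simp add: pole_def)

lemma pole_square: "pole \<diamondop> pole = vec_sum w"
  using pole_pairing[of w] by (simp add: pole_def)

lemma A_carrier: "x \<in> A \<Longrightarrow> x \<in> carrier_vec (p + q)"
  using X by (auto simp: aff_cols_def)

text \<open>
Every point has coordinates by surjectivity, and pairing with the pole tells whether these sum to 1.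
\<close>

lemma A_eq: "A = {x \<in> carrier_vec (p + q). pole \<diamondop> x = 1}"
proof (intro equalityI subsetI)
  fix x assume x: "x \<in> {x \<in> carrier_vec (p + q). pole \<diamondop> x = 1}"
  then have "vec_sum (R *\<^sub>v x) = 1"
    using pole_pairing[of "R *\<^sub>v x"] by simp
  then show "x \<in> A"
    unfolding aff_cols_def using x by (intro CollectI exI[of _ "R *\<^sub>v x"]) simp
qed (auto simp: aff_cols_def pole_pairing)

lemma center_in_A: "center \<in> A"
  using total_nonzero by (simp add: A_eq center_def form_pq_smult_right pole_square)

lemma direction_eq: "direction A = {u \<in> carrier_vec (p + q). pole \<diamondop> u = 0}"
proof (intro equalityI subsetI)
  fix u assume u: "u \<in> {u \<in> carrier_vec (p + q). pole \<diamondop> u = 0}"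
  have "pole \<diamondop> (center + u) = pole \<diamondop> center + pole \<diamondop> u"
    using u by (simp add: form_pq_add_right)
  then have "center + u \<in> A" using u center_in_A by (auto simp: A_eq)
  moreover have "u = (center + u) - center"
    using u by (intro eq_vecI) auto
  ultimately show "u \<in> direction A" using center_in_A unfolding direction_def by blast
qed (auto simp: direction_def A_eq form_pq_diff_right)

text \<open>
Since \<open>\<langle>pole, pole\<rangle> \<noteq> 0\<close>, the pole and the direction space of \<open>A\<close> span everything.  Subtracting from
a perpendicular vector its component along the pole leaves a vector orthogonal to both, which
vanishes.
\<close>

lemma perpendicular_iff:
  assumes u: "u \<in> carrier_vec (p + q)"
  shows "perpendicular p q u A \<longleftrightarrow> (\<exists>k. u = k \<cdot>\<^sub>v pole)"
proof
  assume perp: "perpendicular p q u A"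
  let ?m = "vec_sum w"
  define k where "k = (u \<diamondop> pole) / ?m"
  have "u - k \<cdot>\<^sub>v pole = 0\<^sub>v (p + q)"
  proof (rule form_pq_nondegenerate)
    fix x :: "real vec" assume x: "x \<in> carrier_vec (p + q)"
    \<comment> \<open>The component of x in the direction space.\<close>
    let ?d = "x - ((pole \<diamondop> x) / ?m) \<cdot>\<^sub>v pole"
    have "?d \<in> direction A"
      using x total_nonzero by (simp add: direction_eq form_pq_diff_right form_pq_smult_right pole_square)
    then have "u \<diamondop> ?d = 0" using perp by (auto simp: perpendicular_def)
    then have "u \<diamondop> x = (pole \<diamondop> x) / ?m * (u \<diamondop> pole)"
      using x by (simp add: form_pq_diff_right form_pq_smult_right)
    then show "(u - k \<cdot>\<^sub>v pole) \<diamondop> x = 0"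
      using x u by (simp add: form_pq_diff_left form_pq_smult_left k_def)
  qed (use u in simp)
  then have "(u - k \<cdot>\<^sub>v pole) $ i = 0" if "i < p + q" for i
    using that by simp
  then have "u = k \<cdot>\<^sub>v pole"
    using u by (intro eq_vecI) auto
  then show "\<exists>k. u = k \<cdot>\<^sub>v pole" ..
qed (auto simp: perpendicular_def direction_eq form_pq_smult_left)

lemma center_perpendicular: "perpendicular p q center A"
  by (auto simp: perpendicular_iff center_def)

lemma center_unique:
  assumes x: "x \<in> A" and "perpendicular p q x A"
  shows "x = center"
proof -
  obtain k where k: "x = k \<cdot>\<^sub>v pole"
    using assms A_carrier perpendicular_iff by blast
  then have "k * vec_sum w = 1"
    using x by (simp add: A_eq form_pq_smult_right pole_square)
  then have "k = 1 / vec_sum w" using total_nonzero by (simp add: field_simps)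
  then show ?thesis by (simp add: k center_def)
qed

lemma qs_center_eq: "qs_center p q A = center"
  unfolding qs_center_def
  using center_in_A center_perpendicular center_unique by (intro the_equality) blast+

lemma center_square: "center \<diamondop> center = 1 / vec_sum w"
  using total_nonzero
  by (simp add: center_def form_pq_smult_left form_pq_smult_right pole_square)

text \<open>
A direction orthogonal to all directions is a multiple of the pole and is itself orthogonal to the
pole.
\<close>

lemma nondegenerate_A: "nondegenerate p q A"
  unfolding nondegenerate_def
proof (intro ballI impI)
  fix d assume d: "d \<in> direction A" and orth: "\<forall>d' \<in> direction A. d \<diamondop> d' = 0"
  have carr: "d \<in> carrier_vec (p + q)" and "pole \<diamondop> d = 0" using d by (auto simp: direction_eq)
  moreover obtain k where "d = k \<cdot>\<^sub>v pole"
    using orth carr by (auto simp: perpendicular_iff perpendicular_def[symmetric])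
  ultimately show "d = 0\<^sub>v (p + q)"
    using total_nonzero by (auto simp: form_pq_smult_right pole_square)
qed

text \<open>
The Pythagorean theorem: on \<open>A\<close> the pairing with the center is constant.
\<close>

lemma sphere_section_eq:
  "A \<inter> unit_sphere p q = quasi_sphere p q A center (1 - center \<diamondop> center)"
proof -
  have "v \<diamondop> v = 1 \<longleftrightarrow> (center - v) \<diamondop> (center - v) = 1 - center \<diamondop> center" if v: "v \<in> A" for v
  proof -
    have c: "v \<in> carrier_vec (p + q)" using v by (rule A_carrier)
    have "center \<diamondop> (v - center) = 0"
      using perpendicularD[OF center_perpendicular center_in_A v] .
    then have "center \<diamondop> v = center \<diamondop> center"
      using c by (simp add: form_pq_diff_right)
    then show ?thesis
      using c form_pq_commute[of v p q center]
      by (simp add: form_pq_diff_left form_pq_diff_right) 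
  qed
  then show ?thesis
    using A_carrier by (auto simp: unit_sphere_def quasi_sphere_def)
qed

text \<open>
By \<open>Z = X\<^sup>t I X\<close> the vector \<open>Za\<close> depends only on \<open>Xa\<close>, and the center is also the image of \<open>w\<close>
divided by its sum.
\<close>

lemma weighting_of_center:
  assumes a: "a \<in> carrier_vec n" and c: "X *\<^sub>v a = center"
  shows "is_weighting Z (vec_sum w \<cdot>\<^sub>v a)"
proof -
  have "Z *\<^sub>v (vec_sum w \<cdot>\<^sub>v a) = vec_sum w \<cdot>\<^sub>v (Z *\<^sub>v a)"
    using a by (rule mult_mat_vec[OF Z_carrier])
  also have "Z *\<^sub>v a = Z *\<^sub>v ((1 / vec_sum w) \<cdot>\<^sub>v w)"
    using a c by (simp add: Z_mult center_def pole_def mult_mat_vec[OF X])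
  also have "\<dots> = (1 / vec_sum w) \<cdot>\<^sub>v vec n (\<lambda>_. 1)"
    by (simp add: mult_mat_vec[OF Z_carrier] Z_w)
  finally show ?thesis
    using a total_nonzero by (auto simp: is_weighting_def smult_smult_assoc)
qed

text \<open>
The perpendicular vectors are the multiples of the pole, whose square is the sum of \<open>w\<close>.
\<close>

lemma perpendicular_vectors_spacelike_iff:
  "(\<forall>u \<in> carrier_vec (p + q). u \<noteq> 0\<^sub>v (p + q) \<and> perpendicular p q u A \<longrightarrow> spacelike_vec p q u)
    \<longleftrightarrow> vec_sum w > 0" (is "?L \<longleftrightarrow> _")
proof
  assume L: ?L
  have "pole \<noteq> 0\<^sub>v (p + q)"
    using pole_square total_nonzero by (auto simp: form_pq_sum)
  moreover have "perpendicular p q pole A"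
    unfolding perpendicular_iff[OF pole_carrier] by (intro exI[of _ 1]) simp
  ultimately have "spacelike_vec p q pole" using L by simp
  then show "vec_sum w > 0" by (simp add: spacelike_vec_def pole_square)
next
  assume pos: "vec_sum w > 0"
  show ?L
  proof (intro ballI impI, elim conjE)
    fix u assume u: "u \<in> carrier_vec (p + q)" "u \<noteq> 0\<^sub>v (p + q)" "perpendicular p q u A"
    then obtain k where k: "u = k \<cdot>\<^sub>v pole" using perpendicular_iff by blast
    then have "k \<noteq> 0" using u(2) by auto
    then have "k * k * vec_sum w > 0" using pos by (simp add: zero_less_mult_iff) linarith
    then have "u \<diamondop> u > 0"
      by (simp add: k form_pq_smult_left form_pq_smult_right pole_square mult_ac)
    then show "spacelike_vec p q u" using u by (simp add: spacelike_vec_def)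
  qed
qed

end

section \<open>Barycentric coordinates of interior points\<close>

context weighted_configuration
begin

text \<open>
The right inverse \<open>R\<close> turns a displacement \<open>u\<close> of the point into the displacement \<open>Ru\<close> of its
coordinates.  The coordinate sum stays 1 automatically as long as the point stays in \<open>A\<close>, and by
boundedness of \<open>R\<close> small displacements keep the coordinates positive.
\<close>

lemma interior_conv_if_positive:
  assumes a: "a \<in> carrier_vec n" "vec_sum a = 1" and pos: "\<And>i. i < n \<Longrightarrow> a $ i > 0"
  shows "X *\<^sub>v a \<in> interior_in A (conv_cols X)"
proof -
  have x: "X *\<^sub>v a \<in> A" using a by (auto simp: aff_cols_def)
  obtain \<delta> where \<delta>: "\<delta> > 0" "\<And>i. i < n \<Longrightarrow> \<delta> \<le> a $ i"
    using positive_lower_bound[of n "\<lambda>i. a $ i"] pos by auto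
  obtain c where c: "c > 0" "\<And>u i. u \<in> carrier_vec (p + q) \<Longrightarrow> i < n \<Longrightarrow> \<bar>(R *\<^sub>v u) $ i\<bar> \<le> c * sqrt (u \<bullet> u)"
    using abs_mult_mat_vec_le[OF R] by auto
  have "y \<in> conv_cols X" if y: "y \<in> A" and near: "sqrt ((y - X *\<^sub>v a) \<bullet> (y - X *\<^sub>v a)) < \<delta> / c" for y
  proof -
    let ?u = "y - X *\<^sub>v a"
    define b where "b = a + R *\<^sub>v ?u"
    have yc: "y \<in> carrier_vec (p + q)" using y by (rule A_carrier)
    have u: "?u \<in> carrier_vec (p + q)" using yc a by simp
    have b: "b \<in> carrier_vec n" using a u by (simp add: b_def)
    have "X *\<^sub>v b = X *\<^sub>v a + ?u"
      unfolding b_def using a u by (subst mult_add_distrib_mat_vec[OF X]) simp_all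
    then have Xb: "X *\<^sub>v b = y" using yc a X by auto
    have "vec_sum b = 1"
      using pole_pairing[OF b] y by (simp add: Xb A_eq)
    moreover have "b $ i \<ge> 0" if i: "i < n" for i
    proof -
      have "\<bar>(R *\<^sub>v ?u) $ i\<bar> \<le> c * sqrt (?u \<bullet> ?u)" by (rule c(2)[OF u i])
      also have "\<dots> < \<delta>" using near c(1) by (simp add: field_simps)
      finally have "\<bar>(R *\<^sub>v ?u) $ i\<bar> < \<delta>" .
      moreover have "b $ i = a $ i + (R *\<^sub>v ?u) $ i"
        unfolding b_def using i by (intro index_add_vec) auto
      ultimately show ?thesis using \<delta>(2)[OF i] by linarith
    qed
    ultimately show ?thesis using b Xb X by (auto simp: conv_cols_def)
  qed
  then show ?thesis
    using x \<delta>(1) c(1) by (auto simp: interior_in_def intro!: exI[of _ "\<delta> / c"])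
qed

text \<open>
Moving from the barycenter through an interior point \<open>x\<close> slightly beyond it ends at a point of the
hull.  Then \<open>x\<close> is a convex combination of that point and the barycenter, and the barycenter
contributes a positive amount to every coordinate.
\<close>

lemma positive_if_interior_conv:
  assumes x: "x \<in> interior_in A (conv_cols X)"
  shows "\<exists>a \<in> carrier_vec n. vec_sum a = 1 \<and> (\<forall>i<n. a $ i > 0) \<and> X *\<^sub>v a = x"
proof -
  have xA: "x \<in> A" using x by (simp add: interior_in_def)
  have xc: "x \<in> carrier_vec (p + q)" using xA by (rule A_carrier)
  obtain e where e: "e > 0" "\<And>y. y \<in> A \<Longrightarrow> sqrt ((y - x) \<bullet> (y - x)) < e \<Longrightarrow> y \<in> conv_cols X"
    using x by (auto simp: interior_in_def)
  \<comment> \<open>An empty configuration has total weight 0; otherwise the barycenter exists.\<close>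
  have n: "n > 0"
  proof (rule ccontr)
    assume "\<not> n > 0"
    then have "vec_sum w = 0" using w_carrier by (simp add: vec_sum_def)
    then show False using total_nonzero by simp
  qed
  define g where "g = vec n (\<lambda>_. 1 / real n)"
  have g: "g \<in> carrier_vec n" "vec_sum g = 1" using n by (auto simp: g_def vec_sum_def)
  let ?d = "x - X *\<^sub>v g"
  have d: "?d \<in> carrier_vec (p + q)" using xc g by simp
  define N where "N = sqrt (?d \<bullet> ?d)"
  have N: "N \<ge> 0" "?d \<bullet> ?d \<ge> 0" by (auto simp: N_def scalar_prod_def sum_nonneg)
  \<comment> \<open>The summand 1 keeps the denominator positive when x is the barycenter itself.\<close>
  define t where "t = e / (N + 1)"
  have t: "t > 0" "t * N < e" using e(1) N by (auto simp: t_def field_simps)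
  define y where "y = x + t \<cdot>\<^sub>v ?d"
  have yx: "y - x = t \<cdot>\<^sub>v ?d" using xc d by (intro eq_vecI) (auto simp: y_def)
  have "pole \<diamondop> y = pole \<diamondop> x + t * (pole \<diamondop> ?d)"
    using xc d by (simp add: y_def form_pq_add_right form_pq_smult_right)
  then have "y \<in> A"
    using xA xc g by (auto simp: A_eq form_pq_diff_right pole_pairing y_def)
  moreover have "sqrt ((y - x) \<bullet> (y - x)) = t * N"
    using d t by (simp add: yx N_def real_sqrt_mult mult.assoc[symmetric])
  ultimately obtain b where b: "b \<in> carrier_vec n" "\<And>i. i < n \<Longrightarrow> b $ i \<ge> 0" "vec_sum b = 1" "X *\<^sub>v b = y"
    using e(2)[of y] t X by (auto simp: conv_cols_def)
  \<comment> \<open>Solving y = x + t (x - Xg) for x gives these coefficients.\<close>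
  define a where "a = (1 / (1 + t)) \<cdot>\<^sub>v (b + t \<cdot>\<^sub>v g)"
  have a: "a \<in> carrier_vec n" using b g by (simp add: a_def)
  have "vec_sum a = 1"
    using b g t by (simp add: a_def vec_sum_smult vec_sum_add)
  moreover have "a $ i > 0" if "i < n" for i
    using that b(1) b(2)[OF that] t g n by (auto simp: a_def g_def add_nonneg_pos)
  moreover have "X *\<^sub>v a = x"
  proof -
    have "X *\<^sub>v a = (1 / (1 + t)) \<cdot>\<^sub>v (y + t \<cdot>\<^sub>v (X *\<^sub>v g))"
      using b g by (simp add: a_def mult_mat_vec[OF X] mult_add_distrib_mat_vec[OF X])
    also have "\<dots> = x"
    proof (rule eq_vecI)
      fix i assume "i < dim_vec x"
      then have i: "i < p + q" using xc by auto
      have "y $ i = x $ i + t * (x $ i - (X *\<^sub>v g) $ i)"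
        unfolding y_def using i xc d X_mult_carrier[OF g(1)] by (simp del: index_mult_mat_vec)
      then show "((1 / (1 + t)) \<cdot>\<^sub>v (y + t \<cdot>\<^sub>v (X *\<^sub>v g))) $ i = x $ i"
        using i t xc d X by (simp add: y_def field_simps del: index_mult_mat_vec)
    qed (use xc d X in \<open>auto simp: y_def\<close>)
    finally show ?thesis .
  qed
  ultimately show ?thesis using a by blast
qed

end

section \<open>Magnitude and the center\<close>

text \<open>
Stated for an arbitrary frame because the spacelike condition provides a frame of its own, different
from the given vectors.
\<close>

lemma weighted_configuration_of_frame:
  assumes Z: "Z \<in> carrier_mat n n" and sym: "transpose_mat Z = Z"
    and sig: "signature Z = (p, q, r)" and frame: "is_frame n p q r Z v"
    and w: "is_weighting Z w" and "vec_sum w \<noteq> 0"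
  shows "weighted_configuration p q n (V_pq p q n v) Z w"
proof -
  have n: "p + q + r = n" by (rule signature_sum[OF Z sym sig])
  have v: "lin_indep_family n v"
    and gram: "Z = transpose_mat (V_mat n v) * I_mat p q r * V_mat n v"
    using frame by (auto simp: is_frame_def)
  show ?thesis
  proof
    show "V_pq p q n v \<in> carrier_mat (p + q) n" by (auto simp: V_pq_def)
    show "\<exists>R \<in> carrier_mat n (p + q). V_pq p q n v * R = 1\<^sub>m (p + q)"
      using frame_right_inverse[OF v] n by simp
  qed (use gram_matrix_truncate[OF v n gram] w assms(6) in auto)
qed

theorem theorem3p1:
  fixes Z :: "real mat" and n p q r :: nat and v :: "nat \<Rightarrow> real vec"
    and A :: "real vec set" and Kinv :: real
  assumes "Z \<in> carrier_mat n n"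
    and "transpose_mat Z = Z"
    and "\<And>i. i < n \<Longrightarrow> Z $$ (i, i) = 1"
    and "signature Z = (p, q, r)"
    and "lin_indep_family n v"
    and "Z = transpose_mat (V_mat n v) * I_mat p q r * V_mat n v"
    and "\<exists>w. is_weighting Z w"
    and "Mag Z \<noteq> 0"
    and "A = aff_span p q n v"
    and "Kinv = qs_radial_square p q A"
  shows
    "(nondegenerate p q A
      \<and> (\<exists>!x. x \<in> A \<and> perpendicular p q x A)
      \<and> A \<inter> unit_sphere p q = quasi_sphere p q A (qs_center p q A) Kinv)
     \<and> (1 - Kinv \<noteq> 0 \<and> Mag Z = 1 / (1 - Kinv))
     \<and> (\<forall>a \<in> carrier_vec n.
           vec_sum a = 1 \<and> V_pq p q n v *\<^sub>v a = qs_center p q A \<longrightarrow>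
             form_pq p q (V_pq p q n v *\<^sub>v a) (V_pq p q n v *\<^sub>v a) \<noteq> 0
             \<and> mat_form Z a a \<noteq> 0
             \<and> is_weighting Z ((1 / (1 - Kinv)) \<cdot>\<^sub>v a)
             \<and> (1 / (1 - Kinv)) \<cdot>\<^sub>v a
                 = (1 / form_pq p q (V_pq p q n v *\<^sub>v a) (V_pq p q n v *\<^sub>v a)) \<cdot>\<^sub>v a
             \<and> (1 / form_pq p q (V_pq p q n v *\<^sub>v a) (V_pq p q n v *\<^sub>v a)) \<cdot>\<^sub>v a
                 = (1 / mat_form Z a a) \<cdot>\<^sub>v a)
     \<and> ((\<exists>w. is_weighting Z w \<and> positive_vec w) \<longleftrightarrow>
           spacelike_mat Z \<and> qs_center p q A \<in> interior_in A (conv_cols (V_pq p q n v)))"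
proof -
  let ?X = "V_pq p q n v"
  obtain w where w: "is_weighting Z w" using assms(7) by blast
  have mag: "Mag Z = vec_sum w" by (rule Mag_eq_vec_sum[OF assms(1,2) w])
  have conf: "weighted_configuration p q n (V_pq p q n u) Z w" if "is_frame n p q r Z u" for u
    using weighted_configuration_of_frame[OF assms(1,2,4) that w] assms(8) mag by simp
  interpret weighted_configuration p q n ?X Z w
    by (rule conf) (simp add: is_frame_def assms(5,6))
  have A: "A = aff_cols ?X" by (simp add: assms(9) aff_span_def)
  have center: "qs_center p q A = center" by (simp add: A qs_center_eq)
  have Kinv: "1 - Kinv = 1 / vec_sum w"
    by (simp add: assms(10) qs_radial_square_def center center_square)
  have geometry: "nondegenerate p q A
      \<and> (\<exists>!x. x \<in> A \<and> perpendicular p q x A)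
      \<and> A \<inter> unit_sphere p q = quasi_sphere p q A (qs_center p q A) Kinv"
  proof (intro conjI)
    show "\<exists>!x. x \<in> A \<and> perpendicular p q x A"
      unfolding A using center_in_A center_perpendicular center_unique by blast
    show "A \<inter> unit_sphere p q = quasi_sphere p q A (qs_center p q A) Kinv"
      by (simp add: assms(10) qs_radial_square_def center, simp add: A sphere_section_eq)
  qed (simp add: A nondegenerate_A)
  have magnitude: "1 - Kinv \<noteq> 0 \<and> Mag Z = 1 / (1 - Kinv)"
    using total_nonzero by (simp add: Kinv mag)
  have weights: "form_pq p q (?X *\<^sub>v a) (?X *\<^sub>v a) \<noteq> 0
             \<and> mat_form Z a a \<noteq> 0
             \<and> is_weighting Z ((1 / (1 - Kinv)) \<cdot>\<^sub>v a)
             \<and> (1 / (1 - Kinv)) \<cdot>\<^sub>v a = (1 / form_pq p q (?X *\<^sub>v a) (?X *\<^sub>v a)) \<cdot>\<^sub>v a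
             \<and> (1 / form_pq p q (?X *\<^sub>v a) (?X *\<^sub>v a)) \<cdot>\<^sub>v a = (1 / mat_form Z a a) \<cdot>\<^sub>v a"
    if a: "a \<in> carrier_vec n" and c: "?X *\<^sub>v a = qs_center p q A" for a
    using weighting_of_center[OF a] total_nonzero c
    by (simp add: Kinv mat_form_eq_form[OF a a] center center_square)
  have positivity: "(\<exists>w. is_weighting Z w \<and> positive_vec w) \<longleftrightarrow>
      spacelike_mat Z \<and> qs_center p q A \<in> interior_in A (conv_cols ?X)" (is "_ \<longleftrightarrow> ?S \<and> ?I")
  proof (intro iffI conjI)
    assume "\<exists>w. is_weighting Z w \<and> positive_vec w"
    then obtain w' where w': "is_weighting Z w'" "positive_vec w'" by blast
    have w'n: "w' \<in> carrier_vec n" using w'(1) by (simp add: is_weighting_def)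
    have sum: "vec_sum w' = vec_sum w" using Mag_eq_vec_sum[OF assms(1,2) w'(1)] mag by simp
    have pos: "w' $ i > 0" if "i < n" for i
      using w'(2) w'n that by (auto simp: positive_vec_def)
    have "vec_sum w' \<ge> 0"
      unfolding vec_sum_def using pos w'n by (intro sum_nonneg) (auto intro: less_imp_le)
    with sum total_nonzero have total_pos: "vec_sum w > 0" by simp
    have "is_frame n p q r Z v" by (simp add: is_frame_def assms(5,6))
    then show ?S
      unfolding spacelike_mat_def aff_span_def Z_dim
      using w assms(4) total_pos perpendicular_vectors_spacelike_iff by blast
    let ?a = "(1 / vec_sum w) \<cdot>\<^sub>v w'"
    have a: "?a \<in> carrier_vec n" "vec_sum ?a = 1"
      using w'n sum total_nonzero by (auto simp: vec_sum_smult)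
    have "?X *\<^sub>v ?a = center"
      using w'n by (simp add: center_def mult_mat_vec[OF X] image_of_weighting[OF w'(1)])
    moreover have "?X *\<^sub>v ?a \<in> interior_in (aff_cols ?X) (conv_cols ?X)"
      using a pos w'n total_pos by (intro interior_conv_if_positive) auto
    ultimately show ?I by (simp only: center) (simp only: A)
  next
    assume "?S \<and> ?I"
    then have S: ?S and I: ?I by auto
    obtain u where u: "is_frame n p q r Z u"
      and space: "\<forall>x \<in> carrier_vec (p + q). x \<noteq> 0\<^sub>v (p + q)
        \<and> perpendicular p q x (aff_span p q n u) \<longrightarrow> spacelike_vec p q x"
      using S assms(4) unfolding spacelike_mat_def Z_dim by auto
    interpret other: weighted_configuration p q n "V_pq p q n u" Z w by (rule conf[OF u])
    \<comment> \<open>The spacelike condition concerns the frame u, but yields the sign of the common total weight.\<close>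
    have total_pos: "vec_sum w > 0"
      using space other.perpendicular_vectors_spacelike_iff by (simp add: aff_span_def)
    obtain a where a: "a \<in> carrier_vec n" "\<forall>i<n. a $ i > 0" "?X *\<^sub>v a = center"
      using positive_if_interior_conv I unfolding center unfolding A by blast
    have "is_weighting Z (vec_sum w \<cdot>\<^sub>v a)" by (rule weighting_of_center[OF a(1,3)])
    moreover have "positive_vec (vec_sum w \<cdot>\<^sub>v a)"
      using a(1,2) total_pos by (auto simp: positive_vec_def)
    ultimately show "\<exists>w. is_weighting Z w \<and> positive_vec w" by blast
  qed
  show ?thesis
    using geometry magnitude weights positivity by blast
qed

end
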